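(* Consider BDF1 (backward Euler) with stepsize $k$ for $y'=f(y)$, followed by a linear time filter of arbitrary finite length: $$\tilde y_{n+m}-y_{n+m-1}=k f(\tilde y_{n+m}),$$ $$y_{n+m}=\tilde y_{n+m}-\big(c_m\tilde y_{n+m}+c_{m-1}y_{n+m-1}+\cdots+c_0y_n\big),\qquad c_m\neq 0.$$ This method is of no higher than second order consistency.
   Context: Here $m\ge 1$ is an integer, $c_0,\dots,c_m$ are real filter coefficients, $y_{n+i}$ approximates the solution at time $t_{n+i}$, with $t_{j+1}-t_j=k$ for all $j$, and $\tilde y_{n+m}$ is the intermediate (pre-filter) approximation at $t_{n+m}$. Order of consistency is understood in the sense of one-leg methods. The method is written in one-leg form $$\sum_{i=0}^m\bar\alpha_i y_{n+i}=f\Big(\sum_{i=0}^m\beta_i y_{n+i}\Big)$$ by solving the filter equation for $\tilde y_{n+m}$, namely $$\tilde y_{n+m}=\frac{1}{1-c_m}\big(y_{n+m}+c_{m-1}y_{n+m-1}+\cdots+c_0y_n\big)=\sum_{i=0}^m\beta_i y_{n+i},$$ and substituting this into the backward Euler step, so that $\sum_{i=0}^m\bar\alpha_i y_{n+i}=k^{-1}\big(\sum_{i=0}^m\beta_i y_{n+i}-y_{n+m-1}\big)$. For a one-leg method with coefficients $\bar\alpha_i,\beta_i$, put $t^*=\sum_{i=0}^m\beta_i t_{n+i}$ and define the differentiation and interpolation error operators $$(L_d\phi)(t^* )=\sum_{i=0}^m\bar\alpha_i\phi(t_{n+i})-\phi'(t^* ),\qquad (L_i\phi)(t^* )=\sum_{i=0}^m\beta_i\phi(t_{n+i})-\phi(t^*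 ).$$ Let $p_d$ (resp. $p_i$) be the largest integer such that $L_d\phi$ (resp. $L_i\phi$) is zero for all polynomials $\phi$ of degree at most $p_d$ (resp. $p_i$). The order of the method is $\min(p_d,p_i+1)$. *)

theory Defs
  imports Complex_Main "HOL-Computational_Algebra.Polynomial"
begin

text \<open>
  One step of backward Euler for the equation \<open>y' = f y\<close> followed by the linear time filter with coefficients
  \<open>c 0, \<dots>, c m\<close>; \<open>yt\<close> is the intermediate (pre-filter) value. The filter combines \<open>yt\<close> itself
  (weight \<open>c m\<close>) with the \<open>m\<close> previously computed filtered values.
\<close>

definition bdf1_filter_step ::
    "real \<Rightarrow> ('a::real_vector \<Rightarrow> 'a) \<Rightarrow> nat \<Rightarrow> (nat \<Rightarrow> real) \<Rightarrow> (nat \<Rightarrow> 'a) \<Rightarrow> nat \<Rightarrow> 'a \<Rightarrow> bool" where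
  "bdf1_filter_step k f m c y n yt \<longleftrightarrow>
     yt - y (n + m - 1) = k *\<^sub>R f yt \<and>
     y (n + m) = yt - (c m *\<^sub>R yt + (\<Sum>i<m. c i *\<^sub>R y (n + i)))"

definition one_leg_step ::
    "nat \<Rightarrow> (nat \<Rightarrow> real) \<Rightarrow> (nat \<Rightarrow> real) \<Rightarrow> ('a::real_vector \<Rightarrow> 'a) \<Rightarrow> (nat \<Rightarrow> 'a) \<Rightarrow> nat \<Rightarrow> bool" where
  "one_leg_step m \<alpha> \<beta> f y n \<longleftrightarrow>
     (\<Sum>i\<le>m. \<alpha> i *\<^sub>R y (n + i)) = f (\<Sum>i\<le>m. \<beta> i *\<^sub>R y (n + i))"

text \<open>
  One-leg coefficients of the filtered method, obtained by solving the filter equation for the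
  intermediate value. They are meaningful only for \<open>c m \<noteq> 1\<close>, \<open>k \<noteq> 0\<close> and \<open>m \<ge> 1\<close>;
  see \<open>bdf1_filter_step_iff_one_leg_step\<close>.
\<close>

definition bdf1_filter_beta :: "nat \<Rightarrow> (nat \<Rightarrow> real) \<Rightarrow> nat \<Rightarrow> real" where
  "bdf1_filter_beta m c i = (if i = m then 1 else c i) / (1 - c m)"

definition bdf1_filter_alpha :: "real \<Rightarrow> nat \<Rightarrow> (nat \<Rightarrow> real) \<Rightarrow> nat \<Rightarrow> real" where
  "bdf1_filter_alpha k m c i =
     (bdf1_filter_beta m c i - (if i = m - 1 then 1 else 0)) / k"

lemma bdf1_filter_beta_sum:
  fixes y :: "nat \<Rightarrow> 'a::real_vector"
  assumes "c m \<noteq> 1"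
  shows "y (n + m) = yt - (c m *\<^sub>R yt + (\<Sum>i<m. c i *\<^sub>R y (n + i))) \<longleftrightarrow>
         yt = (\<Sum>i\<le>m. bdf1_filter_beta m c i *\<^sub>R y (n + i))"
proof -
  let ?S = "\<Sum>i<m. c i *\<^sub>R y (n + i)"
  have "(\<Sum>i\<le>m. bdf1_filter_beta m c i *\<^sub>R y (n + i)) =
        (\<Sum>i<m. bdf1_filter_beta m c i *\<^sub>R y (n + i)) + bdf1_filter_beta m c m *\<^sub>R y (n + m)"
    by (simp add: lessThan_Suc_atMost[symmetric])
  also have "(\<Sum>i<m. bdf1_filter_beta m c i *\<^sub>R y (n + i)) = (1 / (1 - c m)) *\<^sub>R ?S"
    unfolding scaleR_sum_right by (intro sum.cong) (auto simp: bdf1_filter_beta_def)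
  finally have B: "(\<Sum>i\<le>m. bdf1_filter_beta m c i *\<^sub>R y (n + i)) =
                   (1 / (1 - c m)) *\<^sub>R (y (n + m) + ?S)"
    by (simp add: bdf1_filter_beta_def algebra_simps)
  have "y (n + m) = yt - (c m *\<^sub>R yt + ?S) \<longleftrightarrow> (1 - c m) *\<^sub>R yt = y (n + m) + ?S"
    by (auto simp: algebra_simps)
  also have "\<dots> \<longleftrightarrow> yt = (1 / (1 - c m)) *\<^sub>R (y (n + m) + ?S)"
  proof
    assume "(1 - c m) *\<^sub>R yt = y (n + m) + ?S"
    then show "yt = (1 / (1 - c m)) *\<^sub>R (y (n + m) + ?S)"
      using assms by (simp flip: \<open>(1 - c m) *\<^sub>R yt = y (n + m) + ?S\<close>)
  qed (use assms in simp)
  finally show ?thesis using B by simp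
qed

lemma bdf1_filter_alpha_sum:
  fixes y :: "nat \<Rightarrow> 'a::real_vector"
  assumes "m \<ge> 1"
  shows "(\<Sum>i\<le>m. bdf1_filter_alpha k m c i *\<^sub>R y (n + i)) =
         (1 / k) *\<^sub>R ((\<Sum>i\<le>m. bdf1_filter_beta m c i *\<^sub>R y (n + i)) - y (n + m - 1))"
proof -
  have "(\<Sum>i\<le>m. (if i = m - 1 then 1 else 0) *\<^sub>R y (n + i)) =
        (\<Sum>i\<le>m. if i = m - 1 then y (n + i) else 0)"
    by (intro sum.cong) auto
  also have "\<dots> = y (n + m - 1)"
    using assms by (simp add: sum.delta)
  finally have 1: "(\<Sum>i\<le>m. (if i = m - 1 then 1 else 0) *\<^sub>R y (n + i)) = y (n + m - 1)" .
  have "(\<Sum>i\<le>m. bdf1_filter_alpha k m c i *\<^sub>R y (n + i)) =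
        (\<Sum>i\<le>m. (1 / k) *\<^sub>R (bdf1_filter_beta m c i *\<^sub>R y (n + i)
                  - (if i = m - 1 then 1 else 0) *\<^sub>R y (n + i)))"
    unfolding bdf1_filter_alpha_def
    by (intro sum.cong) (auto simp flip: scaleR_left_diff_distrib)
  also have "\<dots> = (1 / k) *\<^sub>R ((\<Sum>i\<le>m. bdf1_filter_beta m c i *\<^sub>R y (n + i)) - y (n + m - 1))"
    unfolding scaleR_sum_right[symmetric] sum_subtractf 1 ..
  finally show ?thesis .
qed

lemma bdf1_filter_step_iff_one_leg_step:
  fixes y :: "nat \<Rightarrow> 'a::real_vector"
  assumes "m \<ge> 1" "k \<noteq> 0" "c m \<noteq> 1"
  shows "(\<exists>yt. bdf1_filter_step k f m c y n yt) \<longleftrightarrow>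
         one_leg_step m (bdf1_filter_alpha k m c) (bdf1_filter_beta m c) f y n"
proof -
  have "u = k *\<^sub>R v \<longleftrightarrow> (1 / k) *\<^sub>R u = v" for u v :: 'a
    using assms(2) by auto
  then show ?thesis
    unfolding bdf1_filter_step_def one_leg_step_def bdf1_filter_beta_sum[of c m, OF assms(3)]
      bdf1_filter_alpha_sum[OF assms(1)]
    by blast
qed

definition one_leg_tstar :: "nat \<Rightarrow> (nat \<Rightarrow> real) \<Rightarrow> (nat \<Rightarrow> real) \<Rightarrow> nat \<Rightarrow> real" where
  "one_leg_tstar m \<beta> t n = (\<Sum>i\<le>m. \<beta> i * t (n + i))"

definition diff_error ::
    "nat \<Rightarrow> (nat \<Rightarrow> real) \<Rightarrow> (nat \<Rightarrow> real) \<Rightarrow> (nat \<Rightarrow> real) \<Rightarrow> nat \<Rightarrow> real poly \<Rightarrow> real" where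
  "diff_error m \<alpha> \<beta> t n \<phi> =
     (\<Sum>i\<le>m. \<alpha> i * poly \<phi> (t (n + i))) - poly (pderiv \<phi>) (one_leg_tstar m \<beta> t n)"

definition interp_error ::
    "nat \<Rightarrow> (nat \<Rightarrow> real) \<Rightarrow> (nat \<Rightarrow> real) \<Rightarrow> nat \<Rightarrow> real poly \<Rightarrow> real" where
  "interp_error m \<beta> t n \<phi> =
     (\<Sum>i\<le>m. \<beta> i * poly \<phi> (t (n + i))) - poly \<phi> (one_leg_tstar m \<beta> t n)"

text \<open>
  The exactness degrees range over the integers, so an operator that does not even annihilate the
  constants has degree \<open>-1\<close>. \<open>Greatest\<close> is unspecified when there is no largest such
  integer. For the interpolation operator this happens exactly when the interpolation is exact on
  all polynomials, as for unfiltered backward Euler; for the coefficients above with \<open>m \<ge> 1\<close>,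
  \<open>k \<noteq> 0\<close> and \<open>c m \<notin> {0, 1}\<close> both maxima exist.
\<close>

definition diff_degree ::
    "nat \<Rightarrow> (nat \<Rightarrow> real) \<Rightarrow> (nat \<Rightarrow> real) \<Rightarrow> (nat \<Rightarrow> real) \<Rightarrow> nat \<Rightarrow> int" where
  "diff_degree m \<alpha> \<beta> t n =
     (GREATEST p. \<forall>\<phi>. int (degree \<phi>) \<le> p \<longrightarrow> diff_error m \<alpha> \<beta> t n \<phi> = 0)"

definition interp_degree :: "nat \<Rightarrow> (nat \<Rightarrow> real) \<Rightarrow> (nat \<Rightarrow> real) \<Rightarrow> nat \<Rightarrow> int" where
  "interp_degree m \<beta> t n =
     (GREATEST p. \<forall>\<phi>. int (degree \<phi>) \<le> p \<longrightarrow> interp_error m \<beta> t n \<phi> = 0)"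

definition one_leg_order ::
    "nat \<Rightarrow> (nat \<Rightarrow> real) \<Rightarrow> (nat \<Rightarrow> real) \<Rightarrow> (nat \<Rightarrow> real) \<Rightarrow> nat \<Rightarrow> int" where
  "one_leg_order m \<alpha> \<beta> t n = min (diff_degree m \<alpha> \<beta> t n) (interp_degree m \<beta> t n + 1)"

end

(* Exactness of the differentiation operator on polynomials of degree at most 1 forces
   t* = t_{n+m}. On (x - t_{n+m-1})^2 the two operators then disagree, since differentiation
   gives the quadrature value 2 k^2 and interpolation gives k^2. Hence p_d \<ge> 2 and p_i \<ge> 2
   are incompatible, which already bounds the order by 2. *)

theory Submission
  imports Defs
begin

text \<open>\<open>GREATEST\<close> is unspecified unless a maximum is attained. The witness
  \<open>a\<close> supplies it: the solutions between \<open>a\<close> and \<open>b\<close> form a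
  finite nonempty set, and its maximum dominates the solutions below \<open>a\<close> too.\<close>

lemma Greatest_int_le:
  fixes b :: int
  assumes "Q a" and le: "\<And>p. Q p \<Longrightarrow> p \<le> b"
  shows "(GREATEST p. Q p) \<le> b"
proof -
  let ?S = "{p. a \<le> p \<and> p \<le> b \<and> Q p}"
  have fin: "finite ?S"
    by (rule finite_subset[of _ "{a..b}"]) auto
  have "a \<in> ?S"
    using assms by auto
  then have "Max ?S \<in> ?S"
    using Max_in[OF fin] by blast
  moreover have "p \<le> Max ?S" if "Q p" for p
  proof (cases "a \<le> p")
    case True
    then show ?thesis
      using Max_ge[OF fin] that le by auto
  next
    case False
    then show ?thesis
      using Max_ge[OF fin \<open>a \<in> ?S\<close>] by linarith
  qed
  ultimately have "(GREATEST p. Q p) = Max ?S"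
    by (intro Greatest_equality) auto
  then show ?thesis
    using \<open>Max ?S \<in> ?S\<close> by simp
qed

text \<open>Turns one failing polynomial into a bound on either exactness degree. The failure itself
  bounds the admissible \<open>p\<close>, so the maximum exists.\<close>

lemma Greatest_exactness_le:
  fixes L :: "real poly \<Rightarrow> real"
  assumes "degree \<psi> \<le> Suc d" and "L \<psi> \<noteq> 0"
  shows "(GREATEST p. \<forall>\<phi>. int (degree \<phi>) \<le> p \<longrightarrow> L \<phi> = 0) \<le> int d"
proof (rule Greatest_int_le)
  \<comment> \<open>vacuously exact: \<open>degree 0 = 0\<close>, so no polynomial has negative degree\<close>
  show "\<forall>\<phi>. int (degree \<phi>) \<le> -1 \<longrightarrow> L \<phi> = 0"
    by simp
next
  fix p
  assume "\<forall>\<phi>. int (degree \<phi>) \<le> p \<longrightarrow> L \<phi> = 0"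
  then have "p < int (degree \<psi>)"
    using assms(2) by force
  then show "p \<le> int d"
    using assms(1) by linarith
qed

text \<open>The one-leg identity for \<alpha>, read on the scalar sequence
  \<open>poly \<phi> (t j)\<close>: both operators now share the same \<beta>-sum.\<close>

lemma diff_error_bdf1_filter:
  assumes "m \<ge> 1"
  shows "diff_error m (bdf1_filter_alpha k m c) \<beta> t n \<phi> =
    ((\<Sum>i\<le>m. bdf1_filter_beta m c i * poly \<phi> (t (n + i))) - poly \<phi> (t (n + m - 1))) / k
      - poly (pderiv \<phi>) (one_leg_tstar m \<beta> t n)"
  using bdf1_filter_alpha_sum[OF assms, of k c "\<lambda>j. poly \<phi> (t j)" n]
  by (simp add: diff_error_def)

lemma bdf1_filter_not_both_exact:
  assumes "m \<ge> 1" and "k \<noteq> 0"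
    and diff: "\<And>\<phi>. degree \<phi> \<le> 2 \<Longrightarrow>
      diff_error m (bdf1_filter_alpha k m c) (bdf1_filter_beta m c) t n \<phi> = 0"
    and interp: "\<And>\<phi>. degree \<phi> \<le> 2 \<Longrightarrow> interp_error m (bdf1_filter_beta m c) t n \<phi> = 0"
  shows False
proof -
  let ?\<beta> = "bdf1_filter_beta m c"
  define T where "T = t (n + m - 1)"
  define s where "s = one_leg_tstar m ?\<beta> t n"
  define M where "M \<phi> = (\<Sum>i\<le>m. ?\<beta> i * poly \<phi> (t (n + i)))" for \<phi>
  \<comment> \<open>Combined with \<open>I\<close>, this makes the backward Euler quotient from
    \<open>T\<close> to \<open>s\<close> exact on quadratics.\<close>
  have D: "(M \<phi> - poly \<phi> T) / k = poly (pderiv \<phi>) s" if "degree \<phi> \<le> 2" for \<phi>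
    using diff[OF that] diff_error_bdf1_filter[OF \<open>m \<ge> 1\<close>, of k c ?\<beta> t n \<phi>]
    by (simp add: M_def T_def s_def)
  have I: "M \<phi> = poly \<phi> s" if "degree \<phi> \<le> 2" for \<phi>
    using interp[OF that] by (simp add: interp_error_def M_def s_def)
  \<comment> \<open>Centred at \<open>T\<close>, so that the subtracted term
    \<open>poly \<phi> T\<close> vanishes for \<open>?q\<close> and its square.\<close>
  let ?q = "[:-T, 1:]"
  have deg2: "degree (?q\<^sup>2) \<le> 2"
    by (simp add: degree_power_eq)
  have "s - T = k"
    using D[of ?q] I[of ?q] \<open>k \<noteq> 0\<close> by (simp add: pderiv_pCons)
  moreover have "(s - T)\<^sup>2 = 2 * (s - T) * k"
    using D[OF deg2] I[OF deg2] \<open>k \<noteq> 0\<close>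
    by (simp add: pderiv_power pderiv_pCons field_simps power2_eq_square pderiv_mult)
  ultimately show False
    using \<open>k \<noteq> 0\<close> by (simp add: power2_eq_square)
qed

theorem theorem3p3:
  fixes m n :: nat and k :: real and c t :: "nat \<Rightarrow> real"
  assumes "m \<ge> 1"
    and "k > 0"
    and "\<And>j. t (Suc j) - t j = k"
    and "c m \<noteq> 0"
    and "c m \<noteq> 1"
  shows "one_leg_order m (bdf1_filter_alpha k m c) (bdf1_filter_beta m c) t n \<le> 2"
proof -
  let ?\<alpha> = "bdf1_filter_alpha k m c" and ?\<beta> = "bdf1_filter_beta m c"
  obtain \<phi> where \<phi>: "degree \<phi> \<le> 2"
    and "diff_error m ?\<alpha> ?\<beta> t n \<phi> \<noteq> 0 \<or> interp_error m ?\<beta> t n \<phi> \<noteq> 0"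
    \<comment> \<open>Contrapositive: one of the operators fails on a single \<phi> of degree at
      most 2.\<close>
    using bdf1_filter_not_both_exact[of m k c t n] assms(1,2) by force
  then consider "diff_error m ?\<alpha> ?\<beta> t n \<phi> \<noteq> 0" | "interp_error m ?\<beta> t n \<phi> \<noteq> 0"
    by blast
  then show ?thesis
  proof cases
    case 1
    then have "diff_degree m ?\<alpha> ?\<beta> t n \<le> 1"
      using Greatest_exactness_le[of \<phi> 1 "diff_error m ?\<alpha> ?\<beta> t n"] \<phi>
      by (simp add: diff_degree_def)
    then show ?thesis
      by (simp add: one_leg_order_def)
  next
    \<comment> \<open>Here the shift in \<open>p_i + 1\<close> gives the bound 2; a failure of
      differentiation gives even 1.\<close>
    case 2
    then have "interp_degree m ?\<beta> t n \<le> 1"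
      using Greatest_exactness_le[of \<phi> 1 "interp_error m ?\<beta> t n"] \<phi>
      by (simp add: interp_degree_def)
    then show ?thesis
      by (simp add: one_leg_order_def)
  qed
qed

end
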